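(* Let $\delta=\frac{2}{33}$. There is an absolute constant $K>0$ such that for every finite set $A\subset\mathbb{R}$ with $|A|\geq 2$ and all integers $m\geq 2$ and $n\geq 2$, there exist disjoint subsets $B$ and $C$ of $A$ with $A=B\cup C$, $$E^{(m)}_+(B)\leq K|A|^{2m-1-\delta}(\log|A|)^{1-\delta}$$ and $$E^{(n)}_\times(C)\leq K|A|^{2n-1-\delta}(\log|A|)^{1-\delta}.$$
   Context: For a finite set $A$ of real numbers, $|A|$ denotes cardinality, and for an integer $k\geq 2$ the $k$-fold additive and multiplicative energies are $$E^{(k)}_+(A)=\mathrm{card}\{(a_1,\ldots,a_k,a_1',\ldots,a_k')\in A^{2k}: a_1+\cdots+a_k=a_1'+\cdots+a_k'\},$$ $$E^{(k)}_\times(A)=\mathrm{card}\{(a_1,\ldots,a_k,a_1',\ldots,a_k')\in A^{2k}: a_1\cdots a_k=a_1'\cdots a_k'\}.$$ The subsets $B$ and $C$ are allowed to be empty (the energies of the empty set are $0$). *)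

theory Defs
  imports "HOL-Analysis.Analysis"
begin

text \<open>A \<open>k\<close>-tuple over \<open>A\<close> is an element of \<open>{..<k} \<rightarrow>\<^sub>E A\<close>. The extensional function space
  is needed here: it makes tuples correspond one-to-one to functions, so that \<open>card\<close> counts correctly.\<close>

definition add_energy :: "nat \<Rightarrow> real set \<Rightarrow> nat" where
  "add_energy k A = card {(a, a') \<in> ({..<k} \<rightarrow>\<^sub>E A) \<times> ({..<k} \<rightarrow>\<^sub>E A).
     (\<Sum>i<k. a i) = (\<Sum>i<k. a' i)}"

definition mult_energy :: "nat \<Rightarrow> real set \<Rightarrow> nat" where
  "mult_energy k A = card {(a, a') \<in> ({..<k} \<rightarrow>\<^sub>E A) \<times> ({..<k} \<rightarrow>\<^sub>E A).
     (\<Prod>i<k. a i) = (\<Prod>i<k. a' i)}"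

end

theory Submission
  imports Defs
begin

text \<open>Write \<open>N = |A|\<close> and \<open>\<kappa> = N\<^bsup>1/15\<^esup>\<close>. Both energies of order two can be brought
down to \<open>O(\<kappa>\<^sup>4\<^sup>4) = O(N\<^bsup>3 - 1/15\<^esup>)\<close>, with no logarithm, and \<open>1/15 > 2/33\<close>. The passage to
higher order adds one coordinate on each side at a time: once the two new coordinates are chosen, the
number of solutions is a number of collisions between two translates (or nonzero dilates) of the same sum
(or product) function, and by the inequality between arithmetic and geometric means this is at most the
energy of the previous order. Hence each further order costs a factor \<open>N\<^sup>2\<close>, and the constant stays
independent of the order.

For order two, start with \<open>R = A - {0}\<close>. As long as the multiplicative energy of \<open>R\<close> exceeds
\<open>\<kappa>\<^sup>4\<^sup>4 = N\<^sup>3 / \<kappa>\<close>, a piece \<open>S\<close> with \<open>|S| \<approx> N / 4\<kappa>\<close> and small additive energy can be removed from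
\<open>R\<close>. The pieces are disjoint, so at most \<open>4\<kappa>\<close> of them occur. Their union, together with \<open>0\<close> if
\<open>0 \<in> A\<close>, is \<open>B\<close>, and what is left at the end is \<open>C\<close>. The additive energy of a union of \<open>n\<close> sets is at
most \<open>n\<^sup>4\<close> times the largest of their energies, so pieces of energy \<open>O(\<kappa>\<^sup>4\<^sup>0)\<close> suffice.

A piece is found as follows. Large multiplicative energy gives a set \<open>P\<close> of \<open>O(\<kappa>\<^sup>1\<^sup>6)\<close> popular ratios
such that many \<open>a \<in> R\<close> are of the form \<open>a = p b\<close> with \<open>p \<in> P\<close>, \<open>b \<in> R\<close> in at least \<open>\<kappa>\<^sup>1\<^sup>4 / 4\<close> ways;
\<open>S\<close> consists of such \<open>a\<close>. If \<open>x\<close> has many representations \<open>x = a - a'\<close> in \<open>S\<close>, then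
\<open>a' = p b - x\<close> for many triples \<open>(p, b, a')\<close>, so the lines of slope \<open>p \<in> P\<close> and intercept \<open>-x\<close> have many
incidences with the grid \<open>R \<times> S\<close>. An incidence bound of Szemeredi-Trotter type therefore limits the
number of popular differences \<open>x\<close>, which bounds the additive energy of \<open>S\<close>.

For a grid such an incidence bound is elementary (\<open>grid_incidences\<close>): cut both axes into short blocks. A
line is monotone, so it meets few cells; if it has more incidences than cells, then it has pairs of points
in a common cell, and each such pair determines the line.\<close>

section \<open>Collisions and energies\<close>

definition collisions :: "('x \<Rightarrow> 'v) \<Rightarrow> 'x set \<Rightarrow> ('y \<Rightarrow> 'v) \<Rightarrow> 'y set \<Rightarrow> nat" where
  "collisions f X g Y = card {(x, y) \<in> X \<times> Y. f x = g y}"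

abbreviation energy :: "('x \<Rightarrow> 'v) \<Rightarrow> 'x set \<Rightarrow> nat" where
  "energy f X \<equiv> collisions f X f X"

definition reps :: "('x \<Rightarrow> 'v) \<Rightarrow> 'x set \<Rightarrow> 'v \<Rightarrow> nat" where
  "reps f X v = card {x \<in> X. f x = v}"

lemma collisions_eq_sum_reps:
  assumes "finite X" "finite Y" "finite V" "f ` X \<subseteq> V"
  shows "collisions f X g Y = (\<Sum>v\<in>V. reps f X v * reps g Y v)"
proof -
  have "{(x, y) \<in> X \<times> Y. f x = g y} = (\<Union>v\<in>V. {x \<in> X. f x = v} \<times> {y \<in> Y. g y = v})"
    using assms by auto
  moreover have "card \<dots> = (\<Sum>v\<in>V. card ({x \<in> X. f x = v} \<times> {y \<in> Y. g y = v}))"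
    by (rule card_UN_disjoint) (use assms in auto)
  ultimately show ?thesis by (simp add: collisions_def reps_def card_cartesian_product)
qed

lemma sum_reps:
  assumes "finite X" "finite V"
  shows "(\<Sum>v\<in>V. reps f X v) = card {x \<in> X. f x \<in> V}"
proof -
  have "{x \<in> X. f x \<in> V} = (\<Union>v\<in>V. {x \<in> X. f x = v})" by auto
  moreover have "card \<dots> = (\<Sum>v\<in>V. card {x \<in> X. f x = v})"
    by (rule card_UN_disjoint) (use assms in auto)
  ultimately show ?thesis by (simp add: reps_def)
qed

text \<open>This replaces the Cauchy-Schwarz inequality throughout: wherever mixed collisions occur, both energies on
the right have the same upper bound, and nothing is lost by the arithmetic mean.\<close>

lemma collisions_le_mean:
  assumes "finite X" "finite Y"
  shows "2 * collisions f X g Y \<le> energy f X + energy g Y"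
proof -
  let ?V = "f ` X \<union> g ` Y"
  have V: "finite ?V" "f ` X \<subseteq> ?V" "g ` Y \<subseteq> ?V" using assms by auto
  have *: "2 * (a * b) \<le> a * a + b * b" for a b :: nat
  proof -
    have "real (2 * (a * b)) \<le> real (a * a + b * b)"
      using sum_squares_bound[of "real a" "real b"] by (simp add: power2_eq_square mult.assoc)
    then show ?thesis by (simp only: of_nat_le_iff)
  qed
  have "2 * collisions f X g Y = (\<Sum>v\<in>?V. 2 * (reps f X v * reps g Y v))"
    using assms V by (simp add: collisions_eq_sum_reps[of X Y ?V] sum_distrib_left)
  also have "\<dots> \<le> (\<Sum>v\<in>?V. reps f X v * reps f X v + reps g Y v * reps g Y v)"
    by (intro sum_mono *)
  also have "\<dots> = energy f X + energy g Y"
    using assms V by (simp add: collisions_eq_sum_reps[of _ _ ?V] sum.distrib)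
  finally show ?thesis .
qed

lemma collisions_reindex:
  assumes "inj_on h X" "\<And>x. x \<in> X \<Longrightarrow> f x = f' (h x)" "inj_on k Y" "\<And>y. y \<in> Y \<Longrightarrow> g y = g' (k y)"
  shows "collisions f X g Y = collisions f' (h ` X) g' (k ` Y)"
  unfolding collisions_def
proof (rule bij_betw_same_card[of "map_prod h k"])
  show "bij_betw (map_prod h k) {(x, y) \<in> X \<times> Y. f x = g y} {(x, y) \<in> h ` X \<times> k ` Y. f' x = g' y}"
    using assms by (auto simp: bij_betw_def inj_on_def image_iff)
qed

text \<open>Values with fewer than \<open>t\<close> representations contribute at most \<open>t |X|\<close> to the energy. The bound \<open>m\<close> on the
number of representations controls the others.\<close>

lemma popular_values:
  fixes t :: real and m :: nat
  assumes fin: "finite X" and m: "\<And>v. reps f X v \<le> m" and t: "t \<ge> 0"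
  defines "P \<equiv> {v \<in> f ` X. t \<le> reps f X v}"
  shows "card P * t \<le> card X"
    and "energy f X \<le> t * card X + real m * card {x \<in> X. f x \<in> P}"
proof -
  have finP: "finite P" "P \<subseteq> f ` X" using fin by (auto simp: P_def)
  have "card P * t = (\<Sum>v\<in>P. t)" by simp
  also have "\<dots> \<le> (\<Sum>v\<in>P. real (reps f X v))" by (rule sum_mono) (simp add: P_def)
  also have "\<dots> = card {x \<in> X. f x \<in> P}" using sum_reps[OF fin finP(1), of f] by (simp flip: of_nat_sum)
  also have "\<dots> \<le> card X" using fin by (auto intro!: card_mono)
  finally show "card P * t \<le> card X" .
  have "real (energy f X) = (\<Sum>v\<in>f ` X. real (reps f X v * reps f X v))"
    using fin by (simp add: collisions_eq_sum_reps[of X X "f ` X"])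
  also have "\<dots> \<le> (\<Sum>v\<in>f ` X. t * reps f X v + (if v \<in> P then real m * reps f X v else 0))"
  proof (rule sum_mono)
    fix v assume v: "v \<in> f ` X"
    show "real (reps f X v * reps f X v) \<le> t * reps f X v + (if v \<in> P then real m * reps f X v else 0)"
    proof (cases "v \<in> P")
      case True
      have "real (reps f X v * reps f X v) \<le> real m * reps f X v"
        unfolding of_nat_mult by (intro mult_right_mono) (use m in auto)
      moreover have "0 \<le> t * reps f X v" using t by simp
      ultimately show ?thesis using True by simp
    next
      case False
      then have "reps f X v \<le> t" using v by (simp add: P_def)
      then show ?thesis using False by (simp add: mult_right_mono)
    qed
  qed
  also have "\<dots> = t * (\<Sum>v\<in>f ` X. real (reps f X v)) + m * (\<Sum>v\<in>P. real (reps f X v))"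
    using finP fin by (simp add: sum.distrib sum_distrib_left sum.inter_restrict[symmetric] inf.absorb2)
  also have "(\<Sum>v\<in>f ` X. real (reps f X v)) = card X"
  proof -
    have "{x \<in> X. f x \<in> f ` X} = X" by auto
    then show ?thesis using sum_reps[OF fin, of "f ` X" f] fin by (simp flip: of_nat_sum)
  qed
  also have "(\<Sum>v\<in>P. real (reps f X v)) = card {x \<in> X. f x \<in> P}"
    using sum_reps[OF fin finP(1), of f] by (simp flip: of_nat_sum)
  finally show "energy f X \<le> t * card X + real m * card {x \<in> X. f x \<in> P}" .
qed

abbreviation sum_energy :: "real set \<Rightarrow> nat" where
  "sum_energy A \<equiv> energy (\<lambda>(a, b). a + b) (A \<times> A)"

abbreviation prod_energy :: "real set \<Rightarrow> nat" where
  "prod_energy A \<equiv> energy (\<lambda>(a, b). a * b) (A \<times> A)"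

text \<open>Rearranging \<open>a + b = c + d\<close> into \<open>a - c = d - b\<close> separates the two sets, so that the mixed energy of \<open>A\<close> and
\<open>B\<close> can be compared with the energies of \<open>A\<close> and of \<open>B\<close>.\<close>

lemma sum_energy_eq_difference:
  "energy (\<lambda>(a, b). a + b) (A \<times> B) = collisions (\<lambda>(a, b). a - b) (A \<times> A) (\<lambda>(a, b). a - b) (B \<times> B)"
  for A B :: "real set"
  unfolding collisions_def
proof (rule bij_betw_same_card)
  show "bij_betw (\<lambda>((a, b), (c, d)). ((a, c), (d, b)))
     {(x, y) \<in> (A \<times> B) \<times> A \<times> B. (case x of (a, b) \<Rightarrow> a + b) = (case y of (a, b) \<Rightarrow> a + b)}
     {(x, y) \<in> (A \<times> A) \<times> B \<times> B. (case x of (a, b) \<Rightarrow> a - b) = (case y of (a, b) \<Rightarrow> a - b)}"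
    by (rule bij_betwI[where g = "\<lambda>((a, c), (d, b)). ((a, b), (c, d))"]) auto
qed

lemma prod_energy_eq_quotient:
  assumes "0 \<notin> A"
  shows "prod_energy A = energy (\<lambda>(a, b). a / b) (A \<times> A)"
  unfolding collisions_def
proof (rule bij_betw_same_card)
  have swap: "a / d = c / b \<longleftrightarrow> a * b = c * d" if "b \<in> A" "d \<in> A" for a b c d
    using that assms by (metis frac_eq_eq)
  show "bij_betw (\<lambda>((a, b), (c, d)). ((a, d), (c, b)))
     {(x, y) \<in> (A \<times> A) \<times> A \<times> A. (case x of (a, b) \<Rightarrow> a * b) = (case y of (a, b) \<Rightarrow> a * b)}
     {(x, y) \<in> (A \<times> A) \<times> A \<times> A. (case x of (a, b) \<Rightarrow> a / b) = (case y of (a, b) \<Rightarrow> a / b)}"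
    by (rule bij_betwI[where g = "\<lambda>((a, d), (c, b)). ((a, b), (c, d))"]) (use assms in \<open>auto simp: swap\<close>)
qed

text \<open>Distribute the four coordinates over the sets of the family. Each of the \<open>|F|\<^sup>4\<close> classes is bounded by
applying \<open>collisions_le_mean\<close> twice: once to pass from four sets to two, then, in the difference form, from
two sets to one.\<close>

lemma sum_energy_UN_le:
  fixes F :: "real set set" and H :: nat
  assumes F: "finite F" "\<And>S. S \<in> F \<Longrightarrow> finite S" "\<And>S. S \<in> F \<Longrightarrow> sum_energy S \<le> H"
  shows "sum_energy (\<Union>F) \<le> card F ^ 4 * H"
proof -
  let ?s = "\<lambda>(a, b). a + b :: real"
  have mixed: "energy ?s (S \<times> T) \<le> H" if "S \<in> F" "T \<in> F" for S T
  proof -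
    have "2 * energy ?s (S \<times> T) \<le> sum_energy S + sum_energy T"
      unfolding sum_energy_eq_difference by (rule collisions_le_mean) (use F(2) that in auto)
    then show ?thesis using F(3)[of S] F(3)[of T] that by linarith
  qed
  have four: "collisions ?s (S \<times> T) ?s (S' \<times> T') \<le> H" if "S \<in> F" "T \<in> F" "S' \<in> F" "T' \<in> F" for S T S' T'
    using collisions_le_mean[of "S \<times> T" "S' \<times> T'" ?s ?s] F(2) that mixed[of S T] mixed[of S' T'] by simp
  let ?I = "(F \<times> F) \<times> (F \<times> F)"
  let ?Q = "\<lambda>((S, T), (S', T')). {(x, y) \<in> (S \<times> T) \<times> (S' \<times> T'). ?s x = ?s y}"
  have "{(x, y) \<in> (\<Union>F \<times> \<Union>F) \<times> (\<Union>F \<times> \<Union>F). ?s x = ?s y} \<subseteq> (\<Union>i\<in>?I. ?Q i)"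
  proof clarify
    fix a b c d S T S' T'
    assume "a + b = c + d" "a \<in> S" "S \<in> F" "b \<in> T" "T \<in> F" "c \<in> S'" "S' \<in> F" "d \<in> T'" "T' \<in> F"
    then show "((a, b), (c, d)) \<in> (\<Union>i\<in>?I. ?Q i)"
      by (intro UN_I[of "((S, T), (S', T'))"]) auto
  qed
  moreover have "finite (\<Union>i\<in>?I. ?Q i)"
  proof (rule finite_UN_I)
    show "finite (?Q i)" if "i \<in> ?I" for i
      by (rule finite_subset[of _ "(\<Union>F \<times> \<Union>F) \<times> (\<Union>F \<times> \<Union>F)"]) (use that F in auto)
  qed (use F in auto)
  ultimately have "sum_energy (\<Union>F) \<le> card (\<Union>i\<in>?I. ?Q i)"
    unfolding collisions_def by (intro card_mono)
  also have "\<dots> \<le> (\<Sum>i\<in>?I. card (?Q i))" using F by (intro card_UN_le) auto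
  also have "\<dots> \<le> (\<Sum>i\<in>?I. H)"
    by (rule sum_mono) (use four in \<open>auto simp: collisions_def\<close>)
  also have "\<dots> = card F ^ 4 * H"
    by (simp add: card_cartesian_product power4_eq_xxxx mult.assoc)
  finally show ?thesis .
qed

section \<open>Incidences of lines with a grid\<close>

text \<open>The block of \<open>b\<close> is its rank among the elements of \<open>R\<close>, divided by the block length \<open>g\<close>. It is defined on
all reals, which makes it monotone without restriction to \<open>R\<close>.\<close>

lemma rank_blocks:
  fixes R :: "real set" and g :: nat
  assumes "finite R" "g > 0"
  obtains \<beta> :: "real \<Rightarrow> nat" where "mono \<beta>" "\<And>b. \<beta> b \<le> card R div g"
    "\<And>b. card {b' \<in> R. \<beta> b' = \<beta> b} \<le> g"
proof
  let ?rank = "\<lambda>b. card {y \<in> R. y < b}"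
  let ?\<beta> = "\<lambda>b. ?rank b div g"
  show "mono ?\<beta>"
    by (intro monoI div_le_mono card_mono) (use assms in auto)
  show "?\<beta> b \<le> card R div g" for b
    by (intro div_le_mono card_mono) (use assms in auto)
  have less: "?rank b < ?rank c" if "b \<in> R" "b < c" for b c
    by (rule psubset_card_mono) (use assms that in auto)
  have inj: "inj_on ?rank R"
  proof (rule inj_onI)
    fix b c assume "b \<in> R" "c \<in> R" "?rank b = ?rank c"
    then show "b = c" using less[of b c] less[of c b] by (metis less_irrefl linorder_neqE_linordered_idom)
  qed
  show "card {b' \<in> R. ?\<beta> b' = ?\<beta> b} \<le> g" for b
  proof -
    have "card {b' \<in> R. ?\<beta> b' = ?\<beta> b} \<le> card {?\<beta> b * g..<?\<beta> b * g + g}"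
    proof (rule card_inj_on_le[where f = ?rank])
      show "inj_on ?rank {b' \<in> R. ?\<beta> b' = ?\<beta> b}" using inj by (rule inj_on_subset) auto
      show "?rank ` {b' \<in> R. ?\<beta> b' = ?\<beta> b} \<subseteq> {?\<beta> b * g..<?\<beta> b * g + g}"
      proof clarify
        fix c assume "?\<beta> c = ?\<beta> b"
        then show "?rank c \<in> {?\<beta> b * g..<?\<beta> b * g + g}"
          using div_mult_mod_eq[of "?rank c" g] mod_less_divisor[OF assms(2), of "?rank c"] 
          by (simp only: atLeastLessThan_iff) linarith
      qed
    qed simp
    then show ?thesis by simp
  qed
qed

text \<open>A fibre of size \<open>f > 0\<close> has \<open>f (f - 1) \<ge> f - 1\<close> ordered pairs of distinct elements.\<close>

lemma card_le_fibres:
  assumes "finite T"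
  shows "card T \<le> card (c ` T) + card {(b, b') \<in> T \<times> T. b \<noteq> b' \<and> c b = c b'}"
  using assms
proof (induction T)
  case (insert t T)
  let ?Q = "\<lambda>T. {(b, b') \<in> T \<times> T. b \<noteq> b' \<and> c b = c b'}"
  have fin: "finite (?Q (insert t T))"
    by (rule finite_subset[of _ "insert t T \<times> insert t T"]) (use insert in auto)
  show ?case
  proof (cases "c t \<in> c ` T")
    case True
    then obtain u where u: "u \<in> T" "c u = c t" by auto
    have "card (?Q T) < card (?Q (insert t T))"
      using u insert by (intro psubset_card_mono fin) auto
    then show ?thesis using insert True by (simp add: insert_absorb)
  next
    case False
    have "card (?Q T) \<le> card (?Q (insert t T))" by (intro card_mono fin) auto
    then show ?thesis using insert False by simp
  qed
qed simp

text \<open>Along a line of nonnegative slope both cell coordinates increase weakly, so a cell is determined by the sum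
of its coordinates. For negative slope the second coordinate is reversed.\<close>

lemma line_meets_few_cells:
  fixes \<beta> \<gamma> :: "real \<Rightarrow> nat"
  assumes "finite T" "mono \<beta>" "mono \<gamma>" "\<And>b. \<beta> b \<le> X" "\<And>y. \<gamma> y \<le> Y"
  shows "card ((\<lambda>b. (\<beta> b, \<gamma> (p * b - x))) ` T) \<le> X + Y + 1"
proof -
  let ?y = "\<lambda>b. p * b - x"
  let ?C = "(\<lambda>b. (\<beta> b, \<gamma> (?y b))) ` T"
  define \<phi> where "\<phi> = (\<lambda>(i, j). if p \<ge> 0 then i + j else i + (Y - j))"
  have *: "\<beta> b = \<beta> c \<and> \<gamma> (?y b) = \<gamma> (?y c)"
    if le: "b \<le> c" and eq: "\<phi> (\<beta> b, \<gamma> (?y b)) = \<phi> (\<beta> c, \<gamma> (?y c))" for b c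
  proof (cases "p \<ge> 0")
    case True
    then have "\<gamma> (?y b) \<le> \<gamma> (?y c)"
      using le by (intro monoD[OF assms(3)]) (simp add: mult_left_mono)
    moreover have "\<beta> b \<le> \<beta> c" using le assms(2) by (simp add: monoD)
    ultimately show ?thesis using eq True by (auto simp: \<phi>_def)
  next
    case False
    then have "\<gamma> (?y c) \<le> \<gamma> (?y b)"
      using le by (intro monoD[OF assms(3)]) (simp add: mult_left_mono_neg)
    moreover have "\<beta> b \<le> \<beta> c" using le assms(2) by (simp add: monoD)
    ultimately show ?thesis using eq False assms(5)[of "?y b"] assms(5)[of "?y c"]
      by (auto simp: \<phi>_def)
  qed
  have "inj_on \<phi> ?C"
  proof (rule inj_onI, elim imageE)
    fix u v b c assume h: "\<phi> u = \<phi> v" "u = (\<beta> b, \<gamma> (?y b))" "v = (\<beta> c, \<gamma> (?y c))"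
    show "u = v" using *[of b c] *[of c b] h by (cases "b \<le> c") auto
  qed
  moreover have "\<phi> ` ?C \<subseteq> {..X + Y}"
    using assms(4,5) by (auto simp: \<phi>_def intro!: add_mono le_trans[OF diff_le_self])
  ultimately have "card ?C \<le> card {..X + Y}" by (intro card_inj_on_le) auto
  then show ?thesis by simp
qed

text \<open>The first summand counts one point for each cell that a line meets. The second counts the ordered pairs of
grid points in a common cell: two distinct points of a line that is not vertical have different abscissae
and determine its slope and intercept. Optimizing \<open>g\<close> and \<open>h\<close> gives the Szemeredi-Trotter bound for grids.\<close>

lemma grid_incidences:
  fixes R S :: "real set" and L :: "(real \<times> real) set" and g h :: nat
  assumes fin: "finite R" "finite S" "finite L" and gh: "g > 0" "h > 0"
  shows "card (SIGMA (p, x):L. {b \<in> R. p * b - x \<in> S})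
     \<le> card L * (card R div g + card S div h + 1) + card R * card S * (g * h)"
proof -
  obtain \<beta> where \<beta>: "mono \<beta>" "\<And>b. \<beta> b \<le> card R div g" "\<And>b. card {b' \<in> R. \<beta> b' = \<beta> b} \<le> g"
    using rank_blocks[OF fin(1) gh(1)] by blast
  obtain \<gamma> where \<gamma>: "mono \<gamma>" "\<And>b. \<gamma> b \<le> card S div h" "\<And>b. card {b' \<in> S. \<gamma> b' = \<gamma> b} \<le> h"
    using rank_blocks[OF fin(2) gh(2)] by blast
  let ?T = "\<lambda>(p, x). {b \<in> R. p * b - x \<in> S}"
  let ?c = "\<lambda>(p, x) b. (\<beta> b, \<gamma> (p * b - x))"
  let ?Q = "\<lambda>l. {(b, b') \<in> ?T l \<times> ?T l. b \<noteq> b' \<and> ?c l b = ?c l b'}"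
  have finT: "finite (?T l)" for l using fin by (cases l) auto
  have finQ: "finite (?Q l)" for l
    by (rule finite_subset[of _ "?T l \<times> ?T l"]) (use finT[of l] in auto)
  have line: "card (?T l) \<le> (card R div g + card S div h + 1) + card (?Q l)" for l
  proof -
    have "card (?c l ` ?T l) \<le> card R div g + card S div h + 1"
      using line_meets_few_cells[OF finT[of l] \<beta>(1) \<gamma>(1) \<beta>(2) \<gamma>(2)] by (cases l) auto
    then show ?thesis using card_le_fibres[OF finT[of l], of "?c l"] by linarith
  qed
  let ?W = "SIGMA (b, y):R \<times> S. {b' \<in> R. \<beta> b' = \<beta> b} \<times> {y' \<in> S. \<gamma> y' = \<gamma> y}"
  have finW: "finite ?W" using fin by auto
  have "(\<Sum>l\<in>L. card (?Q l)) = card (SIGMA l:L. ?Q l)"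
    using fin finQ by (simp add: card_SigmaI)
  also have "\<dots> \<le> card ?W"
  proof (rule card_inj_on_le[OF _ _ finW])
    \<comment> \<open>A pair of collinear points in a common cell remembers its line.\<close>
    let ?f = "\<lambda>((p, x), (b, b')). ((b, p * b - x), (b', p * b' - x))"
    show "inj_on ?f (SIGMA l:L. ?Q l)"
    proof (rule inj_onI, clarsimp)
      fix p x p' x' b b' :: real
      assume "b \<noteq> b'" "p * b - x = p' * b - x'" "p * b' - x = p' * b' - x'"
      then have "(p - p') * (b - b') = 0" "b - b' \<noteq> 0" by (auto simp: algebra_simps)
      then have "p = p'" by simp
      then show "p = p' \<and> x = x'" using \<open>p * b - x = p' * b - x'\<close> by simp
    qed
    show "?f ` (SIGMA l:L. ?Q l) \<subseteq> ?W" by auto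
  qed
  also have "\<dots> = (\<Sum>(b, y)\<in>R \<times> S. card {b' \<in> R. \<beta> b' = \<beta> b} * card {y' \<in> S. \<gamma> y' = \<gamma> y})"
    using fin by (subst card_SigmaI) (auto simp: card_cartesian_product intro!: sum.cong)
  also have "\<dots> \<le> (\<Sum>(b, y)\<in>R \<times> S. g * h)"
    by (rule sum_mono) (use \<beta>(3) \<gamma>(3) in \<open>auto intro!: mult_mono\<close>)
  also have "\<dots> = card R * card S * (g * h)" by (simp add: card_cartesian_product)
  finally have pairs: "(\<Sum>l\<in>L. card (?Q l)) \<le> card R * card S * (g * h)" .
  have "card (SIGMA l:L. ?T l) = (\<Sum>l\<in>L. card (?T l))"
    using fin finT by (simp add: card_SigmaI)
  also have "\<dots> \<le> (\<Sum>l\<in>L. (card R div g + card S div h + 1) + card (?Q l))"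
    by (intro sum_mono line)
  also have "\<dots> = card L * (card R div g + card S div h + 1) + (\<Sum>l\<in>L. card (?Q l))"
    by (subst sum.distrib) simp
  finally show ?thesis using pairs by linarith
qed

section \<open>Decomposition for energies of order two\<close>

text \<open>The exponents are the ones for \<open>|R| \<approx> \<kappa>\<^sup>1\<^sup>5\<close>: a popular ratio has at least about \<open>|R| / 2\<kappa>\<close>
representations, and \<open>|S|\<close> has the same order. The threshold \<open>52 \<kappa>\<^sup>1\<^sup>2\<close> for popular differences
balances the two contributions to the additive energy of \<open>S\<close>: those of unpopular differences, at most
\<open>52 \<kappa>\<^sup>1\<^sup>2 |S|\<^sup>2\<close>, and those of the popular ones, of which there are at most \<open>\<kappa>\<^sup>1\<^sup>2\<close> with at most
\<open>|S|\<close> representations each.\<close>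

lemma large_prod_energy_imp_piece_with_small_sum_energy:
  fixes R :: "real set" and \<kappa> :: real
  assumes R: "finite R" "0 \<notin> R" "card R \<le> \<kappa> ^ 15" and \<kappa>: "\<kappa> \<ge> 1"
    and big: "prod_energy R > \<kappa> ^ 44"
  obtains S where "S \<subseteq> R" "\<kappa> ^ 14 / 4 \<le> card S" "sum_energy S \<le> 83 * \<kappa> ^ 40"
proof -
  let ?q = "\<lambda>(a, b). a / b :: real" and ?d = "\<lambda>(a, b). a - b :: real"
  have \<kappa>_pos: "\<kappa> ^ i > 0" "\<kappa> ^ i \<ge> 1" for i using \<kappa> by (auto simp: zero_less_power)
  define P where "P = {v \<in> ?q ` (R \<times> R). \<kappa> ^ 14 / 2 \<le> reps ?q (R \<times> R) v}"
  define deg where "deg a = card {b \<in> R. a / b \<in> P}" for a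
  have finP: "finite P" using R by (simp add: P_def)
  have reps_q: "reps ?q (R \<times> R) v \<le> card R" for v
    unfolding reps_def
  proof (rule card_inj_on_le[of snd])
    show "inj_on snd {x \<in> R \<times> R. ?q x = v}"
      using R(2) by (auto simp: inj_on_def)
  qed (use R in auto)
  have RR: "real (card (R \<times> R)) \<le> \<kappa> ^ 30"
    using mult_mono[OF R(3) R(3)] \<kappa>_pos[of 15] by (simp add: card_cartesian_product flip: power_add)
  note pop = popular_values[OF _ reps_q, of "\<kappa> ^ 14 / 2", folded P_def]
  have "card P * (\<kappa> ^ 14 / 2) \<le> \<kappa> ^ 30"
    using pop(1) RR R(1) \<kappa>_pos[of 14] by simp
  then have "card P * \<kappa> ^ 14 \<le> (2 * \<kappa> ^ 16) * \<kappa> ^ 14" by (simp add: mult.assoc flip: power_add)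
  then have cardP: "card P \<le> 2 * \<kappa> ^ 16" using \<kappa>_pos(1)[of 14] by (rule mult_right_le_imp_le)
  define e where "e = card {z \<in> R \<times> R. ?q z \<in> P}"
  have e_deg: "e = (\<Sum>a\<in>R. deg a)"
  proof -
    have "{z \<in> R \<times> R. ?q z \<in> P} = (SIGMA a:R. {b \<in> R. a / b \<in> P})" by auto
    then show ?thesis using R(1) by (simp add: e_def deg_def)
  qed
  have "\<kappa> ^ 44 < (\<kappa> ^ 14 / 2) * card (R \<times> R) + card R * real e"
    using big pop(2) R(1) \<kappa>_pos[of 14] prod_energy_eq_quotient[OF R(2)] by (simp add: e_def)
  also have "\<dots> \<le> (\<kappa> ^ 14 / 2) * \<kappa> ^ 30 + \<kappa> ^ 15 * real e"
    by (intro add_mono mult_mono RR R(3)) (use \<kappa>_pos[of 14] \<kappa>_pos[of 15] in auto)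
  finally have "\<kappa> ^ 15 * (\<kappa> ^ 29 / 2) < \<kappa> ^ 15 * real e" by (simp add: mult.assoc flip: power_add)
  then have e_large: "\<kappa> ^ 29 / 2 < e" by (rule mult_left_less_imp_less) (use \<kappa>_pos(1)[of 15] in simp)
  define H where "H = {a \<in> R. \<kappa> ^ 14 / 4 \<le> deg a}"
  have "real e \<le> (\<Sum>a\<in>R. \<kappa> ^ 14 / 4 + (if a \<in> H then \<kappa> ^ 15 else 0))"
    unfolding e_deg of_nat_sum
  proof (rule sum_mono)
    fix a assume "a \<in> R"
    have "deg a \<le> card R" unfolding deg_def using R(1) by (intro card_mono) auto
    then show "real (deg a) \<le> \<kappa> ^ 14 / 4 + (if a \<in> H then \<kappa> ^ 15 else 0)"
      using R(3) \<kappa>_pos[of 14] \<open>a \<in> R\<close> by (auto simp: H_def)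
  qed
  also have "\<dots> = card R * (\<kappa> ^ 14 / 4) + card H * \<kappa> ^ 15"
    using R(1) by (simp add: sum.distrib sum.If_cases H_def Collect_conj_eq)
  also have "card R * (\<kappa> ^ 14 / 4) \<le> \<kappa> ^ 15 * (\<kappa> ^ 14 / 4)"
    using R(3) \<kappa>_pos[of 14] by (intro mult_right_mono) auto
  finally have "\<kappa> ^ 15 * (\<kappa> ^ 14 / 4) < \<kappa> ^ 15 * card H"
    using e_large by (simp add: mult.commute flip: power_add)
  then have cardH: "\<kappa> ^ 14 / 4 < card H" by (rule mult_left_less_imp_less) (use \<kappa>_pos(1)[of 15] in simp)
  \<comment> \<open>Trimming \<open>H\<close> bounds the size of the piece from above; this is what makes its energy \<open>O(\<kappa>\<^sup>4\<^sup>0)\<close>.\<close>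
  have "nat \<lceil>\<kappa> ^ 14 / 4\<rceil> \<le> card H" using cardH by linarith
  then obtain S where S: "S \<subseteq> H" "card S = nat \<lceil>\<kappa> ^ 14 / 4\<rceil>" "finite S"
    by (rule obtain_subset_with_card_n)
  have SR: "S \<subseteq> R" using S by (auto simp: H_def)
  have S_low: "\<kappa> ^ 14 / 4 \<le> card S" unfolding S(2) by linarith
  have S_up: "card S \<le> 5 / 4 * \<kappa> ^ 14" using \<kappa>_pos[of 14] unfolding S(2) by linarith
  define D where "D = {v \<in> ?d ` (S \<times> S). 52 * \<kappa> ^ 12 \<le> reps ?d (S \<times> S) v}"
  have finD: "finite D" using S by (simp add: D_def)
  have reps_d: "reps ?d (S \<times> S) v \<le> card S" for v
    unfolding reps_def by (rule card_inj_on_le[of snd]) (use S in \<open>auto simp: inj_on_def\<close>)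
  have cardD: "card D \<le> \<kappa> ^ 12"
  proof -
    \<comment> \<open>Blocks of these lengths leave about \<open>\<kappa> ^ 10\<close> blocks on each axis.\<close>
    define g where "g = nat \<lceil>\<kappa> ^ 5\<rceil>"
    define h where "h = nat \<lceil>\<kappa> ^ 4\<rceil>"
    have g: "\<kappa> ^ 5 \<le> g" "g \<le> 2 * \<kappa> ^ 5" "g > 0" using \<kappa>_pos(2)[of 5] unfolding g_def by linarith+
    have h: "\<kappa> ^ 4 \<le> h" "h \<le> 2 * \<kappa> ^ 4" "h > 0" using \<kappa>_pos(2)[of 4] unfolding h_def by linarith+
    \<comment> \<open>\<open>?W\<close>: a popular difference \<open>x = a - a'\<close> together with a factorization \<open>a = p b\<close>; this is an incidence.\<close>
    let ?T = "SIGMA (p, x):P \<times> D. {b \<in> R. p * b - x \<in> S}"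
    let ?W = "SIGMA x:D. SIGMA z:{z \<in> S \<times> S. ?d z = x}. {b \<in> R. fst z / b \<in> P}"
    have "card D * (13 * \<kappa> ^ 26) = (\<Sum>x\<in>D. (52 * \<kappa> ^ 12) * (\<kappa> ^ 14 / 4))"
      by (simp add: mult.assoc flip: power_add)
    also have "\<dots> \<le> (\<Sum>x\<in>D. real (reps ?d (S \<times> S) x) * (\<kappa> ^ 14 / 4))"
      by (intro sum_mono mult_right_mono) (use \<kappa>_pos[of 14] in \<open>auto simp: D_def\<close>)
    also have "\<dots> = (\<Sum>x\<in>D. \<Sum>z\<in>{z \<in> S \<times> S. ?d z = x}. \<kappa> ^ 14 / 4)"
      by (simp add: reps_def)
    also have "\<dots> \<le> (\<Sum>x\<in>D. \<Sum>z\<in>{z \<in> S \<times> S. ?d z = x}. real (deg (fst z)))"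
      by (intro sum_mono) (use S(1) in \<open>auto simp: H_def\<close>)
    also have "\<dots> = card ?W"
      using finD S(3) R(1) by (simp add: card_SigmaI deg_def)
    also have "card ?W \<le> card ?T"
    proof (rule card_inj_on_le)
      let ?f = "\<lambda>(x, z, b). ((fst z / b, x), b) :: (real \<times> real) \<times> real"
      show "inj_on ?f ?W" using R(2) by (auto simp: inj_on_def)
      show "?f ` ?W \<subseteq> ?T"
      proof (rule image_subsetI)
        fix w assume "w \<in> ?W"
        then obtain a a' b where w: "w = (a - a', (a, a'), b)" "a - a' \<in> D" "a' \<in> S" "b \<in> R" "a / b \<in> P"
          by auto
        then have "b \<noteq> 0" using R(2) by auto
        then show "?f w \<in> ?T" using w by simp
      qed
      show "finite ?T" using finP finD R(1) by auto
    qed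
    also have "card ?T \<le> card (P \<times> D) * (card R div g + card S div h + 1) + card R * card S * (g * h)"
      by (rule grid_incidences) (use R S finP finD g h in auto)
    finally have *: "card D * (13 * \<kappa> ^ 26) \<le> real (card P * card D) *
        (real (card R div g) + real (card S div h) + 1) + real (card R) * card S * (real g * h)"
      by (simp only: card_cartesian_product of_nat_add of_nat_mult of_nat_1)
    have div_le: "real (i div j) \<le> real i / real j" for i j :: nat
      using real_of_int_div4[of "int i" "int j"] by (simp flip: zdiv_int)
    have "real (card R div g) \<le> card R / g" by (rule div_le)
    also have "\<dots> \<le> \<kappa> ^ 15 / \<kappa> ^ 5" by (rule frac_le) (use R(3) g \<kappa>_pos[of 5] in auto)
    also have "\<dots> = \<kappa> ^ 10" using \<kappa> by (simp flip: power_diff)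
    finally have c1: "real (card R div g) \<le> \<kappa> ^ 10" .
    have "real (card S div h) \<le> card S / h" by (rule div_le)
    also have "\<dots> \<le> (5 / 4 * \<kappa> ^ 14) / \<kappa> ^ 4" by (rule frac_le) (use S_up h \<kappa>_pos[of 4] in auto)
    also have "\<dots> = 5 / 4 * \<kappa> ^ 10" using \<kappa> by (simp add: field_simps flip: power_add)
    finally have "real (card R div g) + real (card S div h) + 1 \<le> 13 / 4 * \<kappa> ^ 10"
      using c1 \<kappa>_pos(2)[of 10] by linarith
    then have "real (card P * card D) * (real (card R div g) + real (card S div h) + 1)
        \<le> (2 * \<kappa> ^ 16 * card D) * (13 / 4 * \<kappa> ^ 10)"
      unfolding of_nat_mult by (intro mult_mono mult_right_mono cardP) (use \<kappa>_pos[of 16] in auto)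
    moreover have "real (card R) * card S * (real g * h) \<le> \<kappa> ^ 15 * (5 / 4 * \<kappa> ^ 14) * ((2 * \<kappa> ^ 5) * (2 * \<kappa> ^ 4))"
      by (intro mult_mono R(3) S_up g h) (use \<kappa>_pos[of 15] \<kappa>_pos[of 14] \<kappa>_pos[of 5] \<kappa>_pos[of 4] in auto)
    \<comment> \<open>The constant \<open>52\<close> is chosen so that the cell term absorbs only half of the left-hand side.\<close>
    ultimately have "card D * (13 * \<kappa> ^ 26) \<le> 13 / 2 * (card D * \<kappa> ^ 26) + 5 * \<kappa> ^ 38"
      using * by (simp add: mult.commute mult.left_commute flip: power_add)
    then have "card D * \<kappa> ^ 26 \<le> \<kappa> ^ 38" using \<kappa>_pos[of 38] by linarith
    also have "\<dots> = \<kappa> ^ 12 * \<kappa> ^ 26" by (simp add: mult.assoc flip: power_add)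
    finally show ?thesis using \<kappa>_pos(1)[of 26] by (rule mult_right_le_imp_le)
  qed
  have "real (card {z \<in> S \<times> S. ?d z \<in> D}) = (\<Sum>x\<in>D. real (reps ?d (S \<times> S) x))"
    using S(3) finD by (simp add: sum_reps flip: of_nat_sum)
  also have "\<dots> \<le> (\<Sum>x\<in>D. real (card S))" by (intro sum_mono) (simp add: reps_d)
  also have "\<dots> \<le> \<kappa> ^ 12 * card S" using cardD by (simp add: mult_right_mono)
  finally have inD: "real (card {z \<in> S \<times> S. ?d z \<in> D}) \<le> \<kappa> ^ 12 * card S" .
  have "real (sum_energy S) \<le> (52 * \<kappa> ^ 12) * card (S \<times> S) + card S * real (card {z \<in> S \<times> S. ?d z \<in> D})"
    using popular_values(2)[OF _ reps_d, of "52 * \<kappa> ^ 12", folded D_def] S(3) \<kappa>_pos[of 12]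
    by (simp add: sum_energy_eq_difference)
  also have "\<dots> \<le> (52 * \<kappa> ^ 12) * card (S \<times> S) + card S * (\<kappa> ^ 12 * card S)"
    using inD by (intro add_left_mono mult_left_mono) auto
  also have "\<dots> = 53 * \<kappa> ^ 12 * (real (card S) * card S)"
    by (simp add: card_cartesian_product)
  also have "\<dots> \<le> 53 * \<kappa> ^ 12 * ((5 / 4 * \<kappa> ^ 14) * (5 / 4 * \<kappa> ^ 14))"
    by (intro mult_left_mono mult_mono S_up) (use \<kappa>_pos[of 12] \<kappa>_pos[of 14] in auto)
  also have "\<dots> = 1325 / 16 * \<kappa> ^ 40" by (simp add: mult.assoc flip: power_add)
  also have "\<dots> \<le> 83 * \<kappa> ^ 40" using \<kappa>_pos[of 40] by simp
  finally show ?thesis using that SR S_low by blast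
qed

text \<open>The bound on \<open>card F\<close> is stated through the union because this form is additive when a disjoint piece is
added to the family.\<close>

lemma split_into_pieces:
  fixes R :: "real set" and \<kappa> :: real
  assumes "finite R" "0 \<notin> R" "card R \<le> \<kappa> ^ 15" "\<kappa> \<ge> 1"
  shows "\<exists>F C. finite F \<and> \<Union>F \<inter> C = {} \<and> R = \<Union>F \<union> C \<and> card F * (\<kappa> ^ 14 / 4) \<le> card (\<Union>F) \<and>
     (\<forall>S\<in>F. sum_energy S \<le> 83 * \<kappa> ^ 40) \<and> prod_energy C \<le> \<kappa> ^ 44"
  using assms
proof (induction R rule: finite_psubset_induct)
  case (psubset R)
  show ?case
  proof (cases "prod_energy R \<le> \<kappa> ^ 44")
    case True
    then show ?thesis by (intro exI[of _ "{}"] exI[of _ R]) auto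
  next
    case False
    then obtain S where S: "S \<subseteq> R" "\<kappa> ^ 14 / 4 \<le> card S" "sum_energy S \<le> 83 * \<kappa> ^ 40"
      using large_prod_energy_imp_piece_with_small_sum_energy[OF psubset.hyps psubset.prems] by auto
    have "\<kappa> ^ 14 > 0" using psubset.prems by simp
    then have "S \<noteq> {}" using S(2) by auto
    then have "R - S \<subset> R" using S(1) by blast
    moreover have "card (R - S) \<le> card R" using psubset.hyps by (intro card_mono) auto
    then have "card (R - S) \<le> \<kappa> ^ 15" using psubset.prems(2) by linarith
    ultimately obtain F C where FC: "finite F" "\<Union>F \<inter> C = {}" "R - S = \<Union>F \<union> C"
      "card F * (\<kappa> ^ 14 / 4) \<le> card (\<Union>F)" "\<forall>S\<in>F. sum_energy S \<le> 83 * \<kappa> ^ 40" "prod_energy C \<le> \<kappa> ^ 44"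
      using psubset.IH[of "R - S"] psubset.prems(1,3) by blast
    have "S \<inter> \<Union>F = {}" "finite S" "finite (\<Union>F)"
      using FC(3) S(1) psubset.hyps by (auto intro: finite_subset)
    then have "card (\<Union>(insert S F)) = card S + card (\<Union>F)"
      by (simp add: card_Un_disjoint)
    moreover have "card (insert S F) * (\<kappa> ^ 14 / 4) \<le> (card F + 1) * (\<kappa> ^ 14 / 4)"
      using FC(1) \<open>\<kappa> ^ 14 > 0\<close> by (intro mult_right_mono) (auto simp: card_insert_if)
    ultimately have "card (insert S F) * (\<kappa> ^ 14 / 4) \<le> card (\<Union>(insert S F))"
      using FC(4) S(2) by (simp add: algebra_simps)
    moreover have "\<Union>(insert S F) \<inter> C = {}" "R = \<Union>(insert S F) \<union> C"
      using FC(2,3) S(1) by auto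
    ultimately show ?thesis using FC(1,5,6) S(3)
      by (intro exI[of _ "insert S F"] exI[of _ C]) simp
  qed
qed

text \<open>The element \<open>0\<close> must not enter \<open>C\<close>, as the multiplicative arguments divide by elements of the set. It forms
one more piece \<open>A \<inter> {0}\<close> of additive energy at most \<open>1\<close>, so there are at most \<open>4\<kappa> + 1 \<le> 5\<kappa>\<close> pieces.\<close>

lemma low_energy_decomposition:
  fixes A :: "real set" and \<kappa> :: real
  assumes A: "finite A" "card A \<le> \<kappa> ^ 15" and \<kappa>: "\<kappa> \<ge> 1"
  obtains B C where "B \<inter> C = {}" "A = B \<union> C" "0 \<notin> C"
    "sum_energy B \<le> 51875 * \<kappa> ^ 44" "prod_energy C \<le> \<kappa> ^ 44"
proof -
  have "card (A - {0}) \<le> card A" using A by (intro card_mono) auto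
  then obtain F C where FC: "finite F" "\<Union>F \<inter> C = {}" "A - {0} = \<Union>F \<union> C"
      "card F * (\<kappa> ^ 14 / 4) \<le> card (\<Union>F)" "\<forall>S\<in>F. sum_energy S \<le> 83 * \<kappa> ^ 40" "prod_energy C \<le> \<kappa> ^ 44"
    using split_into_pieces[of "A - {0}" \<kappa>] assms by auto
  let ?F = "insert (A \<inter> {0}) F"
  have \<kappa>': "\<kappa> ^ 40 \<ge> 1" "\<kappa> ^ 14 > 0" using \<kappa> by auto
  have "card (\<Union>F) \<le> card A" using A FC(3) by (intro card_mono) auto
  then have "card F * \<kappa> ^ 14 \<le> 4 * \<kappa> ^ 15" using FC(4) A(2) by simp
  also have "\<dots> = (4 * \<kappa>) * \<kappa> ^ 14" by (simp add: eval_nat_numeral)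
  finally have "card F \<le> 4 * \<kappa>" using \<kappa>'(2) by (rule mult_right_le_imp_le)
  then have cardF: "card ?F \<le> 5 * \<kappa>" using FC(1) \<kappa> by (auto simp: card_insert_if)
  have zero: "sum_energy (A \<inter> {0}) \<le> 1"
    unfolding collisions_def by (rule order_trans[OF card_mono[of "{((0, 0), (0, 0))}"]]) auto
  have "sum_energy (\<Union>?F) \<le> card ?F ^ 4 * nat \<lfloor>83 * \<kappa> ^ 40\<rfloor>"
  proof (rule sum_energy_UN_le)
    show "finite S" if "S \<in> ?F" for S
      using that FC(3) A(1) by (auto intro: finite_subset)
    show "sum_energy S \<le> nat \<lfloor>83 * \<kappa> ^ 40\<rfloor>" if "S \<in> ?F" for S
    proof -
      have "sum_energy S \<le> 83 * \<kappa> ^ 40" using that FC(5) zero \<kappa>'(1) by auto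
      then show ?thesis by linarith
    qed
  qed (use FC in auto)
  then have "real (sum_energy (\<Union>?F)) \<le> real (card ?F ^ 4 * nat \<lfloor>83 * \<kappa> ^ 40\<rfloor>)"
    by (simp only: of_nat_le_iff)
  also have "\<dots> \<le> (5 * \<kappa>) ^ 4 * (83 * \<kappa> ^ 40)"
    unfolding of_nat_mult of_nat_power
    by (intro mult_mono power_mono cardF) (use \<kappa> \<kappa>' in auto)
  also have "\<dots> = 51875 * \<kappa> ^ 44" by (simp add: power_mult_distrib mult.assoc flip: power_add)
  finally have energy: "sum_energy (\<Union>?F) \<le> 51875 * \<kappa> ^ 44" .
  have split: "\<Union>?F \<inter> C = {}" "A = \<Union>?F \<union> C" "0 \<notin> C" using FC(2,3) by auto
  show ?thesis by (rule that[OF split energy FC(6)])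
qed

section \<open>Energies of higher order\<close>

text \<open>For fixed last coordinates \<open>x\<close> and \<open>y\<close> the solutions are collisions of \<open>op (G a) x\<close> with \<open>op (G b) y\<close>. Each of
these two functions has the same energy as \<open>G\<close>, because \<open>op\<close> is injective in its first argument.\<close>

lemma energy_extend:
  fixes F G :: "(nat \<Rightarrow> 'a) \<Rightarrow> 'v"
  assumes fin: "finite A" and step: "\<And>a x. F (a(k := x)) = op (G a) x"
    and inj: "\<And>x. x \<in> A \<Longrightarrow> inj (\<lambda>s. op s x)"
  shows "energy F ({..<Suc k} \<rightarrow>\<^sub>E A) \<le> card A ^ 2 * energy G ({..<k} \<rightarrow>\<^sub>E A)"
proof -
  let ?Pi = "{..<k} \<rightarrow>\<^sub>E A"
  let ?X = "A \<times> ?Pi" and ?h = "\<lambda>(x, a). a(k := x)" and ?f = "\<lambda>(x, a). op (G a) x"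
  have finPi: "finite ?Pi" using fin by (simp add: finite_PiE)
  have "{..<Suc k} \<rightarrow>\<^sub>E A = ?h ` ?X"
    unfolding lessThan_Suc PiE_insert_eq by simp
  moreover have "inj_on ?h ?X" by (rule inj_combinator) simp
  ultimately have "energy F ({..<Suc k} \<rightarrow>\<^sub>E A) = energy ?f ?X"
    using collisions_reindex[of ?h ?X ?f F ?h ?X ?f F] step by auto
  also have "\<dots> = card (SIGMA (x, y):A \<times> A. {(a, b) \<in> ?Pi \<times> ?Pi. op (G a) x = op (G b) y})"
    unfolding collisions_def
  proof (rule bij_betw_same_card)
    show "bij_betw (\<lambda>((x, a), (y, b)). ((x, y), (a, b))) {(u, v) \<in> ?X \<times> ?X. ?f u = ?f v}
      (SIGMA (x, y):A \<times> A. {(a, b) \<in> ?Pi \<times> ?Pi. op (G a) x = op (G b) y})"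
      by (rule bij_betwI[where g = "\<lambda>((x, y), (a, b)). ((x, a), (y, b))"]) auto
  qed
  also have "\<dots> = (\<Sum>(x, y)\<in>A \<times> A. collisions (\<lambda>a. op (G a) x) ?Pi (\<lambda>b. op (G b) y) ?Pi)"
  proof -
    have "\<forall>z\<in>A \<times> A. finite (case z of (x, y) \<Rightarrow> {(a, b) \<in> ?Pi \<times> ?Pi. op (G a) x = op (G b) y})"
      by (auto intro: finite_subset[OF _ finite_cartesian_product[OF finPi finPi]])
    then show ?thesis using fin by (simp add: card_SigmaI collisions_def split_beta)
  qed
  also have "\<dots> \<le> (\<Sum>(x, y)\<in>A \<times> A. energy G ?Pi)"
  proof (rule sum_mono, clarify)
    fix x y assume "x \<in> A" "y \<in> A"
    then have "op (G a) x = op (G b) x \<longleftrightarrow> G a = G b" "op (G a) y = op (G b) y \<longleftrightarrow> G a = G b" for a b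
      using inj_eq[OF inj, of x "G a" "G b"] inj_eq[OF inj, of y "G a" "G b"] by simp_all
    then have "energy (\<lambda>a. op (G a) x) ?Pi = energy G ?Pi" "energy (\<lambda>a. op (G a) y) ?Pi = energy G ?Pi"
      unfolding collisions_def by simp_all
    then show "collisions (\<lambda>a. op (G a) x) ?Pi (\<lambda>b. op (G b) y) ?Pi \<le> energy G ?Pi"
      using collisions_le_mean[OF finPi finPi, of "\<lambda>a. op (G a) x" "\<lambda>b. op (G b) y"] by simp
  qed
  also have "\<dots> = card A ^ 2 * energy G ?Pi"
    by (simp add: card_cartesian_product power2_eq_square)
  finally show ?thesis .
qed

lemma tuple_energy_le:
  fixes F :: "nat \<Rightarrow> (nat \<Rightarrow> 'a) \<Rightarrow> 'a"
  assumes fin: "finite A" and step: "\<And>k a x. F (Suc k) (a(k := x)) = op (F k a) x"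
    and base: "\<And>a. F 2 a = op (a 0) (a 1)"
    and inj: "\<And>x. x \<in> A \<Longrightarrow> inj (\<lambda>s. op s x)" and "k \<ge> 2"
  shows "energy (F k) ({..<k} \<rightarrow>\<^sub>E A) \<le> card A ^ (2 * k - 4) * energy (\<lambda>(a, b). op a b) (A \<times> A)"
  using \<open>k \<ge> 2\<close>
proof (induction k rule: dec_induct)
  case base
  let ?h = "\<lambda>a :: nat \<Rightarrow> 'a. (a 0, a 1)"
  have img: "?h ` ({..<2} \<rightarrow>\<^sub>E A) = A \<times> A"
  proof
    show "?h ` ({..<2} \<rightarrow>\<^sub>E A) \<subseteq> A \<times> A"
      by (intro image_subsetI SigmaI; erule PiE_mem; simp)
    show "A \<times> A \<subseteq> ?h ` ({..<2} \<rightarrow>\<^sub>E A)"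
    proof clarify
      fix x y assume "x \<in> A" "y \<in> A"
      then show "(x, y) \<in> ?h ` ({..<2} \<rightarrow>\<^sub>E A)"
        by (intro image_eqI[of _ _ "\<lambda>i\<in>{..<2}. if i = 0 then x else y"]) auto
    qed
  qed
  have inj: "inj_on ?h ({..<2} \<rightarrow>\<^sub>E A)"
  proof (rule inj_onI)
    fix a b assume "a \<in> {..<2} \<rightarrow>\<^sub>E A" "b \<in> {..<2} \<rightarrow>\<^sub>E A" "?h a = ?h b"
    then show "a = b" by (elim PiE_ext) (auto dest: less_2_cases)
  qed
  have "energy (F 2) ({..<2} \<rightarrow>\<^sub>E A) = energy (\<lambda>(a, b). op a b) (?h ` ({..<2} \<rightarrow>\<^sub>E A))"
    by (rule collisions_reindex[OF inj _ inj]) (simp_all add: assms(3))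
  then show ?case unfolding img by simp
next
  case (step k)
  have "energy (F (Suc k)) ({..<Suc k} \<rightarrow>\<^sub>E A) \<le> card A ^ 2 * energy (F k) ({..<k} \<rightarrow>\<^sub>E A)"
    by (rule energy_extend[where op = op], fact fin, fact assms(2), fact assms(4))
  also have "\<dots> \<le> card A ^ 2 * (card A ^ (2 * k - 4) * energy (\<lambda>(a, b). op a b) (A \<times> A))"
    by (intro mult_left_mono step.IH) simp
  also have "\<dots> = card A ^ (2 + (2 * k - 4)) * energy (\<lambda>(a, b). op a b) (A \<times> A)"
    by (simp only: power_add mult.assoc)
  also have "2 + (2 * k - 4) = 2 * Suc k - 4" using step.hyps by simp
  finally show ?case .
qed

lemma add_energy_le:
  assumes "finite A" "k \<ge> 2"
  shows "add_energy k A \<le> card A ^ (2 * k - 4) * sum_energy A"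
proof -
  have "energy (\<lambda>a. \<Sum>i<k. a i) ({..<k} \<rightarrow>\<^sub>E A) \<le> card A ^ (2 * k - 4) * sum_energy A"
    by (rule tuple_energy_le[where F = "\<lambda>k a. \<Sum>i<k. a i" and op = "(+)"])
      (use assms in \<open>auto simp: numeral_2_eq_2 inj_def\<close>)
  then show ?thesis by (simp add: add_energy_def collisions_def)
qed

lemma mult_energy_le:
  assumes "finite A" "0 \<notin> A" "k \<ge> 2"
  shows "mult_energy k A \<le> card A ^ (2 * k - 4) * prod_energy A"
proof -
  have "energy (\<lambda>a. \<Prod>i<k. a i) ({..<k} \<rightarrow>\<^sub>E A) \<le> card A ^ (2 * k - 4) * prod_energy A"
    by (rule tuple_energy_le[where F = "\<lambda>k a. \<Prod>i<k. a i" and op = "(*)"])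
      (use assms in \<open>auto simp: numeral_2_eq_2 inj_def\<close>)
  then show ?thesis by (simp add: mult_energy_def collisions_def)
qed

text \<open>The gain \<open>1/15\<close> in the exponent is at least \<open>\<delta>\<close>, and \<open>(ln N) powr (1 - \<delta>) \<ge> 1/2\<close> already for \<open>N = 2\<close>; this
costs the factor \<open>2\<close>.\<close>

lemma power_bound_le_log_bound:
  fixes N \<kappa> E \<delta> M :: real and b m :: nat
  assumes N: "N \<ge> 2" "\<kappa> ^ 15 = N" "\<kappa> \<ge> 1" and b: "b \<le> N" and m: "m \<ge> 2"
    and \<delta>: "0 \<le> \<delta>" "\<delta> \<le> 1 / 15" and E: "E \<le> real b ^ (2 * m - 4) * (M * \<kappa> ^ 44)" and M: "M \<ge> 0"
  shows "E \<le> 2 * M * N powr (2 * real m - 1 - \<delta>) * ln N powr (1 - \<delta>)"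
proof -
  have \<kappa>: "\<kappa> = N powr (1 / 15)"
  proof -
    have "\<kappa> powr 15 = N" using N by simp
    then show ?thesis using N powr_powr[of \<kappa> 15 "1 / 15"] by simp
  qed
  have ln_half: "1 / 2 \<le> ln N powr (1 - \<delta>)"
  proof (cases "ln N \<ge> 1")
    case True
    then have "1 \<le> ln N powr (1 - \<delta>)" using \<delta> by (intro ge_one_powr_ge_zero) auto
    then show ?thesis by simp
  next
    case False
    have "2 / 3 \<le> ln N" using ln2_ge_two_thirds N(1) by (smt (verit) ln_le_cancel_iff)
    moreover have "ln N powr 1 \<le> ln N powr (1 - \<delta>)"
      by (rule powr_mono') (use False \<delta> N in auto)
    ultimately show ?thesis using N by simp
  qed
  have "E \<le> N ^ (2 * m - 4) * (M * \<kappa> ^ 44)"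
    using E by (rule order_trans) (intro mult_right_mono power_mono b, use M N in auto)
  also have "N ^ (2 * m - 4) = N powr (2 * real m - 4)"
    using N(1) m powr_realpow[of N "2 * m - 4"] by (simp add: of_nat_diff)
  also have "\<kappa> ^ 44 = N powr (44 / 15)"
  proof -
    have "\<kappa> ^ 44 = \<kappa> powr 44" using N(3) by simp
    also have "\<dots> = N powr (1 / 15 * 44)" by (subst \<kappa>) (rule powr_powr)
    finally show ?thesis by simp
  qed
  also have "N powr (2 * real m - 4) * (M * N powr (44 / 15)) = M * N powr (2 * real m - 1 - 1 / 15)"
  proof -
    have "N powr (2 * real m - 4) * N powr (44 / 15) = N powr (2 * real m - 1 - 1 / 15)"
      unfolding powr_add[symmetric] by simp
    then show ?thesis by (simp only: mult.left_commute)
  qed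
  also have "\<dots> \<le> M * N powr (2 * real m - 1 - \<delta>)"
    using N \<delta> M by (intro mult_left_mono powr_mono) auto
  also have "\<dots> \<le> M * N powr (2 * real m - 1 - \<delta>) * (2 * ln N powr (1 - \<delta>))"
    using mult_left_mono[of 1 "2 * ln N powr (1 - \<delta>)" "M * N powr (2 * real m - 1 - \<delta>)"] ln_half M
    by simp
  finally show ?thesis by (simp add: mult_ac)
qed

theorem theorem1p4:
  fixes \<delta> :: real
  assumes "\<delta> = 2 / 33"
  shows "\<exists>K::real. K > 0 \<and>
    (\<forall>A::real set. finite A \<and> card A \<ge> 2 \<longrightarrow>
      (\<forall>m n::nat. m \<ge> 2 \<and> n \<ge> 2 \<longrightarrow>
        (\<exists>B C. B \<inter> C = {} \<and> A = B \<union> C \<and>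
          real (add_energy m B)
            \<le> K * real (card A) powr (2 * real m - 1 - \<delta>) * ln (real (card A)) powr (1 - \<delta>) \<and>
          real (mult_energy n C)
            \<le> K * real (card A) powr (2 * real n - 1 - \<delta>) * ln (real (card A)) powr (1 - \<delta>))))"
proof (intro exI[of _ "2 * 51875"] conjI allI impI, goal_cases)
  case (2 A m n)
  then have A: "finite A" "card A \<ge> 2" and mn: "m \<ge> 2" "n \<ge> 2" by auto
  define \<kappa> where "\<kappa> = root 15 (real (card A))"
  have \<kappa>: "\<kappa> ^ 15 = card A" "\<kappa> \<ge> 1" using A by (auto simp: \<kappa>_def)
  obtain B C where BC: "B \<inter> C = {}" "A = B \<union> C" "0 \<notin> C"
      "sum_energy B \<le> 51875 * \<kappa> ^ 44" "prod_energy C \<le> \<kappa> ^ 44"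
    using low_energy_decomposition[of A \<kappa>] A \<kappa> by auto
  have fin: "finite B" "finite C" "card B \<le> card A" "card C \<le> card A"
    using A BC(2) by (auto intro!: card_mono)
  have "real (add_energy m B) \<le> real (card B ^ (2 * m - 4) * sum_energy B)"
    using add_energy_le[OF fin(1) mn(1)] by (simp only: of_nat_le_iff)
  also have "\<dots> \<le> real (card B) ^ (2 * m - 4) * (51875 * \<kappa> ^ 44)"
    unfolding of_nat_mult of_nat_power using BC(4) by (intro mult_left_mono) auto
  finally have 1: "real (add_energy m B)
      \<le> 2 * 51875 * real (card A) powr (2 * real m - 1 - \<delta>) * ln (real (card A)) powr (1 - \<delta>)"
    by (intro power_bound_le_log_bound[where \<kappa> = \<kappa> and b = "card B"]) (use A \<kappa> fin mn assms in auto)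
  have "real (mult_energy n C) \<le> real (card C ^ (2 * n - 4) * prod_energy C)"
    using mult_energy_le[OF fin(2) BC(3) mn(2)] by (simp only: of_nat_le_iff)
  also have "\<dots> \<le> real (card C) ^ (2 * n - 4) * (51875 * \<kappa> ^ 44)"
    unfolding of_nat_mult of_nat_power using BC(5) \<kappa>(2) by (intro mult_left_mono) auto
  finally have "real (mult_energy n C)
      \<le> 2 * 51875 * real (card A) powr (2 * real n - 1 - \<delta>) * ln (real (card A)) powr (1 - \<delta>)"
    by (intro power_bound_le_log_bound[where \<kappa> = \<kappa> and b = "card C"]) (use A \<kappa> fin mn assms in auto)
  then show ?case using BC(1,2) 1 by blast
qed simp

end
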